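(* Let $q$ be a prime power, let $n>k\ge 2$ be integers, let $G\in\mathbb{F}_q^{k\times n}$ be a matrix of rank $k$ with no zero column, and let $\mathcal{R}=(\mathcal{R}_1,\ldots,\mathcal{R}_k)$ be a $G$-system. Then $$h(\mathcal{R})\le\min\left\{\frac{\lambda(\mathcal{R})}{k},\,\delta(\mathcal{R})\right\}.$$
   Context: Let $G^\nu$ denote the $\nu$-th column of $G$ and $e_i$ the $i$-th standard basis vector (of $\mathbb{F}_q^k$ or of $\mathbb{R}^k$, according to context). For $i\in\{1,\ldots,k\}$ let $\mathcal{R}_i^{\mathrm{all}}(G)=\{R\subseteq\{1,\ldots,n\}\mid e_i\in\langle G^\nu\mid\nu\in R\rangle\}$, where $\langle\cdot\rangle$ is the $\mathbb{F}_q$-span. A $G$-system is a $k$-tuple $\mathcal{R}=(\mathcal{R}_1,\ldots,\mathcal{R}_k)$ with $\emptyset\ne\mathcal{R}_i\subseteq\mathcal{R}_i^{\mathrm{all}}(G)$ for all $i$. The service rate region $\Lambda(\mathcal{R})\subseteq\mathbb{R}^k$ (with server capacity $1$) is the set of all $(\lambda_1,\ldots,\lambda_k)\in\mathbb{R}^k$ for which there exist real numbers $\lambda_{i,R}\ge 0$ ($i\in\{1,\ldots,k\}$, $R\in\mathcal{R}_i$) with $\sum_{R\in\mathcal{R}_i}\lambda_{i,R}=\lambda_i$ for all $i$, and $\sum_{i=1}^k\sum_{R\in\mathcal{R}_i,\,\nu\in R}\lambda_{i,R}\le 1$ for all $\nu\in\{1,\ldots,n\}$. Define $\lambda(\mathcal{R})=\max\{\sum_{i=1}^k\lambda_i\mid\lambda\in\Lambda(\mathcal{R})\}$,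 $h(\mathcal{R})=\max\{x\in\mathbb{R}\mid(x,\ldots,x)\in\Lambda(\mathcal{R})\}$, $\lambda_i^*(\mathcal{R})=\max\{x\in\mathbb{R}\mid xe_i\in\Lambda(\mathcal{R})\}$ for $1\le i\le k$, and $\delta(\mathcal{R})=\min\{\lambda_i^*(\mathcal{R})\mid 1\le i\le k\}$. *)

theory Defs
  imports "HOL-Analysis.Analysis"
begin

text \<open>
  The field \<open>\<F>\<^sub>q\<close> is a type \<open>'q\<close> of class \<open>{field, finite}\<close> (so \<open>q = CARD('q)\<close>), and the index
  sets \<open>{1,\<dots>,k}\<close> and \<open>{1,\<dots>,n}\<close> are finite types \<open>'k\<close> and \<open>'n\<close>. Note that \<^const>\<open>vec.span\<close> is
  the span over \<open>'q\<close>, whereas \<^const>\<open>span\<close> would be the span over the reals.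
\<close>

definition all_recovery_sets :: "'q::field ^ 'n ^ 'k \<Rightarrow> 'k \<Rightarrow> 'n set set"
  where "all_recovery_sets G i =
    {R. axis i 1 \<in> vec.span ((\<lambda>\<nu>. column \<nu> G) ` R)}"

definition G_system :: "'q::field ^ 'n ^ 'k \<Rightarrow> ('k \<Rightarrow> 'n set set) \<Rightarrow> bool"
  where "G_system G \<R> \<longleftrightarrow> (\<forall>i. \<R> i \<noteq> {} \<and> \<R> i \<subseteq> all_recovery_sets G i)"

text \<open>Only the values \<open>a i R\<close> with \<open>R \<in> \<R> i\<close> are relevant below.\<close>

definition service_rate_region :: "('k::finite \<Rightarrow> 'n::finite set set) \<Rightarrow> (real ^ 'k) set"
  where "service_rate_region \<R> =
    {l. \<exists>a :: 'k \<Rightarrow> 'n set \<Rightarrow> real.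
          (\<forall>i. \<forall>R\<in>\<R> i. 0 \<le> a i R) \<and>
          (\<forall>i. (\<Sum>R\<in>\<R> i. a i R) = l $ i) \<and>
          (\<forall>\<nu>. (\<Sum>i\<in>UNIV. \<Sum>R | R \<in> \<R> i \<and> \<nu> \<in> R. a i R) \<le> 1)}"

text \<open>
  The maxima below range over infinite sets of reals, hence \<^const>\<open>Greatest\<close> instead of
  \<^const>\<open>Max\<close>. The value is meaningful only if the maximum is attained, which holds for every
  \<open>G\<close>-system: no recovery set is empty, so the region is compact, and it contains 0.
\<close>

definition max_sum_rate :: "('k::finite \<Rightarrow> 'n::finite set set) \<Rightarrow> real"
  where "max_sum_rate \<R> =
    (GREATEST s. s \<in> {(\<Sum>i\<in>UNIV. l $ i) | l. l \<in> service_rate_region \<R>})"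

definition max_uniform_rate :: "('k::finite \<Rightarrow> 'n::finite set set) \<Rightarrow> real"
  where "max_uniform_rate \<R> = (GREATEST x. (\<chi> i. x) \<in> service_rate_region \<R>)"

definition max_single_rate :: "('k::finite \<Rightarrow> 'n::finite set set) \<Rightarrow> 'k \<Rightarrow> real"
  where "max_single_rate \<R> i = (GREATEST x. x *\<^sub>R axis i 1 \<in> service_rate_region \<R>)"

definition min_single_rate :: "('k::finite \<Rightarrow> 'n::finite set set) \<Rightarrow> real"
  where "min_single_rate \<R> = Min (range (max_single_rate \<R>))"

end

theory Submission
  imports Defs
begin

text \<open>
  Let \<open>h\<close> be the largest uniform rate. The vector \<open>(h, \<dots>, h)\<close> is achievable, and its coordinate
  sum \<open>k h\<close> is then at most the maximal sum rate. Dropping all requests except those for the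
  \<open>i\<close>-th object only relieves the servers, so \<open>h e\<^sub>i\<close> is achievable too, which bounds \<open>h\<close> by every
  maximal single rate.

  This argument compares maxima and is sound only because each of them is attained. Attainment comes
  from compactness of the service rate region, which is the continuous image of the set of feasible
  allocations. That set is closed, being cut out by weak inequalities between linear functions. It is
  bounded because every recovery set contains at least one server, whose capacity caps the rate
  allotted to that set; here it matters that \<open>e\<^sub>i \<noteq> 0\<close> is not in the span of the empty set.
\<close>

lemma Greatest_of_compact:
  fixes S :: "real set"
  assumes "compact S" "S \<noteq> {}"
  shows Greatest_of_compact_mem: "(GREATEST x. x \<in> S) \<in> S"
    and Greatest_of_compact_upper: "y \<in> S \<Longrightarrow> y \<le> (GREATEST x. x \<in> S)"
proof -
  obtain m where m: "m \<in> S" "\<And>y. y \<in> S \<Longrightarrow> y \<le> m"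
    using compact_attains_sup[OF assms] by blast
  then have "(GREATEST x. x \<in> S) = m"
    by (intro Greatest_equality)
  with m show "(GREATEST x. x \<in> S) \<in> S" "y \<in> S \<Longrightarrow> y \<le> (GREATEST x. x \<in> S)"
    by auto
qed

text \<open>
  A continuous left inverse \<open>p\<close> of \<open>c\<close> confines the preimage to the compact set \<open>p ` S\<close>. For curves
  such as \<open>x \<mapsto> (x, \<dots>, x)\<close> and \<open>x \<mapsto> x e\<^sub>i\<close> a coordinate projection serves as \<open>p\<close>.
\<close>

lemma compact_preimage_left_inverse:
  fixes c :: "'a::t2_space \<Rightarrow> 'b::t2_space"
  assumes "compact S" "continuous_on UNIV c" "continuous_on UNIV p" "\<And>x. p (c x) = x"
  shows "compact {x. c x \<in> S}"
proof -
  have "compact (p ` S)"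
    using assms by (blast intro: compact_continuous_image continuous_on_subset)
  moreover have "closed (c -` S)"
    using assms(1,2) by (intro closed_vimage compact_imp_closed)
  moreover have "{x. c x \<in> S} = p ` S \<inter> c -` S"
    by (auto simp: assms(4) intro: rev_image_eqI)
  ultimately show ?thesis
    by (metis compact_Int_closed)
qed

lemma G_system_recovery_set_nonempty:
  assumes "G_system G \<R>" "R \<in> \<R> i"
  shows "R \<noteq> {}"
proof
  assume "R = {}"
  have "axis i 1 \<in> vec.span ((\<lambda>\<nu>. column \<nu> G) ` R)"
    using assms unfolding G_system_def all_recovery_sets_def by blast
  with \<open>R = {}\<close> show False
    by (simp add: axis_eq_0_iff)
qed

text \<open>
  Setting the values outside the recovery system to 0 is what keeps this set bounded; rates are
  unaffected by them.
\<close>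

definition feasible_allocations :: "('k::finite \<Rightarrow> 'n::finite set set) \<Rightarrow> (real ^ 'n set ^ 'k) set"
  where "feasible_allocations \<R> =
    {a. (\<forall>i R. 0 \<le> a $ i $ R) \<and> (\<forall>i R. R \<notin> \<R> i \<longrightarrow> a $ i $ R = 0) \<and>
        (\<forall>\<nu>. (\<Sum>i\<in>UNIV. \<Sum>R | R \<in> \<R> i \<and> \<nu> \<in> R. a $ i $ R) \<le> 1)}"

definition allocation_rates :: "('k::finite \<Rightarrow> 'n::finite set set) \<Rightarrow> real ^ 'n set ^ 'k \<Rightarrow> real ^ 'k"
  where "allocation_rates \<R> a = (\<chi> i. \<Sum>R\<in>\<R> i. a $ i $ R)"

lemma service_rate_region_eq_image:
  "service_rate_region \<R> = allocation_rates \<R> ` feasible_allocations \<R>"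
proof (intro subset_antisym subsetI)
  fix l assume "l \<in> service_rate_region \<R>"
  then obtain a where a: "\<And>i R. R \<in> \<R> i \<Longrightarrow> 0 \<le> a i R" "\<And>i. (\<Sum>R\<in>\<R> i. a i R) = l $ i"
      "\<And>\<nu>. (\<Sum>i\<in>UNIV. \<Sum>R | R \<in> \<R> i \<and> \<nu> \<in> R. a i R) \<le> 1"
    unfolding service_rate_region_def by blast
  define b where "b = (\<chi> i R. if R \<in> \<R> i then a i R else 0)"
  have "b \<in> feasible_allocations \<R>"
    using a(1,3) by (auto simp: b_def feasible_allocations_def)
  moreover have "l = allocation_rates \<R> b"
    using a(2) by (simp add: b_def allocation_rates_def vec_eq_iff)
  ultimately show "l \<in> allocation_rates \<R> ` feasible_allocations \<R>"
    by blast
next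
  fix l assume "l \<in> allocation_rates \<R> ` feasible_allocations \<R>"
  then obtain a where "a \<in> feasible_allocations \<R>" "l = allocation_rates \<R> a"
    by blast
  then show "l \<in> service_rate_region \<R>"
    unfolding service_rate_region_def feasible_allocations_def allocation_rates_def
    by (auto intro!: exI[of _ "\<lambda>i R. a $ i $ R"])
qed

text \<open>
  Any server in a recovery set carries at least the rate allotted to that set, so its capacity bounds
  the rate. The empty set involves no server and could be given an arbitrarily large rate.
\<close>

lemma feasible_allocation_le_1:
  assumes "\<And>i R. R \<in> \<R> i \<Longrightarrow> R \<noteq> {}" "a \<in> feasible_allocations \<R>"
  shows "a $ i $ R \<le> 1"
proof (cases "R \<in> \<R> i")
  case True
  then obtain \<nu> where "\<nu> \<in> R"
    using assms(1) by blast
  have nonneg: "0 \<le> a $ j $ S" for j S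
    using assms(2) by (simp add: feasible_allocations_def)
  have "a $ i $ R \<le> (\<Sum>S | S \<in> \<R> i \<and> \<nu> \<in> S. a $ i $ S)"
    using True \<open>\<nu> \<in> R\<close> nonneg by (intro member_le_sum) auto
  also have "\<dots> \<le> (\<Sum>j\<in>UNIV. \<Sum>S | S \<in> \<R> j \<and> \<nu> \<in> S. a $ j $ S)"
    using nonneg
    by (intro member_le_sum[where f = "\<lambda>j. \<Sum>S | S \<in> \<R> j \<and> \<nu> \<in> S. a $ j $ S"])
      (auto intro: sum_nonneg)
  also have "\<dots> \<le> 1"
    using assms(2) by (simp add: feasible_allocations_def)
  finally show ?thesis .
next
  case False
  then show ?thesis
    using assms(2) by (simp add: feasible_allocations_def)
qed

lemma compact_feasible_allocations:
  assumes "\<And>i R. R \<in> \<R> i \<Longrightarrow> R \<noteq> {}"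
  shows "compact (feasible_allocations \<R>)"
proof -
  have "closed (feasible_allocations \<R>)"
    unfolding feasible_allocations_def
    by (intro closed_Collect_conj closed_Collect_all closed_Collect_imp open_Collect_const
        closed_Collect_le closed_Collect_eq continuous_intros)
  moreover have "feasible_allocations \<R> \<subseteq> cbox 0 1"
  proof
    fix a assume a: "a \<in> feasible_allocations \<R>"
    then have "0 \<le> a $ i $ R" "a $ i $ R \<le> 1" for i R
      using feasible_allocation_le_1[OF assms a] by (simp_all add: feasible_allocations_def)
    then show "a \<in> cbox 0 1"
      by (simp add: cbox_interval less_eq_vec_def)
  qed
  ultimately show ?thesis
    by (meson bounded_cbox bounded_subset compact_eq_bounded_closed)
qed

lemma compact_service_rate_region:
  assumes "\<And>i R. R \<in> \<R> i \<Longrightarrow> R \<noteq> {}"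
  shows "compact (service_rate_region \<R>)"
  unfolding service_rate_region_eq_image allocation_rates_def
  by (intro compact_continuous_image compact_feasible_allocations assms continuous_intros)

lemma zero_in_service_rate_region: "0 \<in> service_rate_region \<R>"
  unfolding service_rate_region_def by (auto intro!: exI[of _ "\<lambda>_ _. 0"])

lemma service_rate_region_single_request:
  assumes "l \<in> service_rate_region \<R>"
  shows "(l $ i) *\<^sub>R axis i 1 \<in> service_rate_region \<R>"
proof -
  obtain a where a: "\<And>i R. R \<in> \<R> i \<Longrightarrow> 0 \<le> a i R" "\<And>i. (\<Sum>R\<in>\<R> i. a i R) = l $ i"
      "\<And>\<nu>. (\<Sum>i\<in>UNIV. \<Sum>R | R \<in> \<R> i \<and> \<nu> \<in> R. a i R) \<le> 1"
    using assms unfolding service_rate_region_def by blast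
  define b where "b j R = (if j = i then a j R else 0)" for j R
  have "(\<Sum>R\<in>\<R> j. b j R) = ((l $ i) *\<^sub>R axis i 1) $ j" for j
    using a(2) by (simp add: b_def axis_def)
  moreover have "(\<Sum>j\<in>UNIV. \<Sum>R | R \<in> \<R> j \<and> \<nu> \<in> R. b j R) \<le> 1" for \<nu>
  proof -
    have "(\<Sum>j\<in>UNIV. \<Sum>R | R \<in> \<R> j \<and> \<nu> \<in> R. b j R) \<le> (\<Sum>j\<in>UNIV. \<Sum>R | R \<in> \<R> j \<and> \<nu> \<in> R. a j R)"
      using a(1) by (intro sum_mono) (auto simp: b_def)
    with a(3)[of \<nu>] show ?thesis
      by linarith
  qed
  ultimately show ?thesis
    using a(1) unfolding service_rate_region_def
    by (auto intro!: exI[of _ b] simp: b_def)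
qed

lemma max_sum_rate_upper:
  assumes "\<And>i R. R \<in> \<R> i \<Longrightarrow> R \<noteq> {}" "l \<in> service_rate_region \<R>"
  shows "(\<Sum>i\<in>UNIV. l $ i) \<le> max_sum_rate \<R>"
proof -
  have "compact ((\<lambda>l. \<Sum>i\<in>UNIV. l $ i) ` service_rate_region \<R>)"
    by (intro compact_continuous_image compact_service_rate_region assms continuous_intros)
  then show ?thesis
    unfolding max_sum_rate_def Setcompr_eq_image using assms(2)
    by (intro Greatest_of_compact_upper) auto
qed

lemma max_single_rate_upper:
  assumes "\<And>i R. R \<in> \<R> i \<Longrightarrow> R \<noteq> {}" "x *\<^sub>R axis i 1 \<in> service_rate_region \<R>"
  shows "x \<le> max_single_rate \<R> i"
proof -
  have "compact {x. x *\<^sub>R axis i 1 \<in> service_rate_region \<R>}"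
    by (rule compact_preimage_left_inverse[where p = "\<lambda>l. l $ i"])
      (intro compact_service_rate_region continuous_intros assms | simp)+
  from Greatest_of_compact_upper[OF this] assms(2) show ?thesis
    unfolding max_single_rate_def by auto
qed

lemma max_uniform_rate_achievable:
  assumes "\<And>i R. R \<in> \<R> i \<Longrightarrow> R \<noteq> {}"
  shows "(\<chi> i. max_uniform_rate \<R>) \<in> service_rate_region \<R>"
proof -
  have "compact {x. (\<chi> i. x) \<in> service_rate_region \<R>}"
    by (rule compact_preimage_left_inverse[where p = "\<lambda>l. l $ undefined"])
      (intro compact_service_rate_region continuous_intros assms | simp)+
  moreover have "0 \<in> {x. (\<chi> i. x) \<in> service_rate_region \<R>}"
    using zero_in_service_rate_region[of \<R>] by (simp add: zero_vec_def)
  ultimately have "(GREATEST x. x \<in> {x. (\<chi> i. x) \<in> service_rate_region \<R>})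
      \<in> {x. (\<chi> i. x) \<in> service_rate_region \<R>}"
    by (intro Greatest_of_compact_mem) auto
  then show ?thesis
    by (simp add: max_uniform_rate_def)
qed

theorem proposition4p4:
  fixes G :: "'q::{field, finite} ^ 'n::finite ^ 'k::finite"
    and \<R> :: "'k \<Rightarrow> 'n set set"
  assumes "CARD('k) \<ge> 2"
    and "CARD('n) > CARD('k)"
    and "rank G = CARD('k)"
    and "\<And>\<nu>. column \<nu> G \<noteq> 0"
    and "G_system G \<R>"
  shows "max_uniform_rate \<R> \<le> min (max_sum_rate \<R> / real CARD('k)) (min_single_rate \<R>)"
proof -
  define h where "h = max_uniform_rate \<R>"
  have nonempty: "R \<noteq> {}" if "R \<in> \<R> i" for i R
    using G_system_recovery_set_nonempty[OF assms(5) that] .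
  have uniform: "(\<chi> i. h) \<in> service_rate_region \<R>"
    unfolding h_def by (intro max_uniform_rate_achievable nonempty)
  have "real CARD('k) * h \<le> max_sum_rate \<R>"
    using max_sum_rate_upper[OF nonempty uniform] by simp
  then have "h \<le> max_sum_rate \<R> / real CARD('k)"
    by (simp add: field_simps)
  moreover have "h \<le> max_single_rate \<R> i" for i
    using service_rate_region_single_request[OF uniform, of i]
    by (intro max_single_rate_upper nonempty) simp_all
  then have "h \<le> min_single_rate \<R>"
    by (simp add: min_single_rate_def)
  ultimately show ?thesis
    by (simp add: h_def)
qed

end
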